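(* Let $\delta\in\mathbb C^\times$ and set $\lambda=2\delta-1$. Assume that $\lambda\neq0$. All algebras are over $\mathbb C$. (i) Every transposed $\delta$-mock-Poisson algebra $(\mathcal A,\ast,\{-,-\})$ is an anti-commutative $\lambda$-mock-Gelfand-Dorfman algebra. (ii) If $\delta\neq\frac34$, then every anti-commutative $\lambda$-mock-Gelfand-Dorfman algebra $(\mathcal A,\ast,\{-,-\})$ is a transposed $\delta$-mock-Poisson algebra. Consequently, for $\delta\notin\{\frac12,\frac34\}$, the varieties of transposed $\delta$-mock-Poisson algebras and anti-commutative $(2\delta-1)$-mock-Gelfand-Dorfman algebras coincide.
   Context: An algebra is a vector space with a bilinear product, not necessarily associative. For a nonzero scalar $\lambda$, a $\lambda$-mock-Novikov algebra is an algebra $(\mathcal A,\circ)$ such that for all $a,b,c\in\mathcal A$ $$\lambda(a\circ b)\circ c+\lambda(b\circ a)\circ c+a\circ(b\circ c)+b\circ(a\circ c)=0,\qquad (a\circ b)\circ c+(a\circ c)\circ b=0.$$ A mock-Lie algebra is a vector space with a symmetric bilinear product $\{-,-\}$ satisfying $\{\{x,y\},z\}+\{\{y,z\},x\}+\{\{z,x\},y\}=0$. A $\lambda$-mock-Gelfand-Dorfman algebra is a triple $(\mathcal A,\circ,\{-,-\})$ where $(\mathcal A,\circ)$ is a $\lambda$-mock-Novikov algebra, $(\mathcal A,\{-,-\})$ is a mock-Lie algebra, and for all $x,y,z\in\mathcal A$ $$\{x,y\circ z\}+\{z,y\circ x\}+\lambda\{y,x\}\circ z+\lambda\{y,z\}\circ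 x+y\circ\{x,z\}=0.$$ It is called anti-commutative if its first multiplication is anti-commutative ($x\circ y=-y\circ x$); in that case this multiplication is written $\ast$. A transposed $\delta$-mock-Poisson algebra is a triple $(\mathcal A,\ast,\{-,-\})$ where $(\mathcal A,\ast)$ is anti-commutative ($x\ast y=-y\ast x$) and anti-associative ($(x\ast y)\ast z=-x\ast(y\ast z)$), $(\mathcal A,\{-,-\})$ is a mock-Lie algebra, and for all $x,y,z\in\mathcal A$ $$-2\delta\,x\ast\{y,z\}=\{x\ast y,z\}+\{y,x\ast z\}.$$ *)

theory Defs
  imports Complex_Main
begin

text \<open>Every type \<open>'a\<close> of class \<open>ab_group_add\<close> with a scalar multiplication satisfying
  \<open>vector_space\<close> is a complex vector space; the product need not be associative and there
  need not be a unit.\<close>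

locale nonassoc_algebra = vector_space scale
  for scale :: "complex \<Rightarrow> 'a::ab_group_add \<Rightarrow> 'a" +
  fixes mult :: "'a \<Rightarrow> 'a \<Rightarrow> 'a"
  assumes linear_left: "Vector_Spaces.linear scale scale (\<lambda>x. mult x y)"
    and linear_right: "Vector_Spaces.linear scale scale (\<lambda>y. mult x y)"

locale mock_novikov_algebra = nonassoc_algebra scale circ
  for lam :: complex
    and scale :: "complex \<Rightarrow> 'a::ab_group_add \<Rightarrow> 'a"
    and circ :: "'a \<Rightarrow> 'a \<Rightarrow> 'a" (infixl "\<odot>" 70) +
  assumes lam_nonzero: "lam \<noteq> 0"
    and left_identity:
      "scale lam ((a \<odot> b) \<odot> c) + scale lam ((b \<odot> a) \<odot> c) + a \<odot> (b \<odot> c) + b \<odot> (a \<odot> c) = 0"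
    and right_identity: "(a \<odot> b) \<odot> c + (a \<odot> c) \<odot> b = 0"

locale mock_lie_algebra = nonassoc_algebra scale bracket
  for scale :: "complex \<Rightarrow> 'a::ab_group_add \<Rightarrow> 'a"
    and bracket :: "'a \<Rightarrow> 'a \<Rightarrow> 'a" ("\<lbrace>_,/ _\<rbrace>") +
  assumes symmetric: "\<lbrace>x, y\<rbrace> = \<lbrace>y, x\<rbrace>"
    and jacobi: "\<lbrace>\<lbrace>x, y\<rbrace>, z\<rbrace> + \<lbrace>\<lbrace>y, z\<rbrace>, x\<rbrace> + \<lbrace>\<lbrace>z, x\<rbrace>, y\<rbrace> = 0"

locale mock_gelfand_dorfman_algebra =
  novikov: mock_novikov_algebra lam scale circ + lie: mock_lie_algebra scale bracket
  for lam :: complex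
    and scale :: "complex \<Rightarrow> 'a::ab_group_add \<Rightarrow> 'a"
    and circ :: "'a \<Rightarrow> 'a \<Rightarrow> 'a" (infixl "\<odot>" 70)
    and bracket :: "'a \<Rightarrow> 'a \<Rightarrow> 'a" ("\<lbrace>_,/ _\<rbrace>") +
  assumes compatibility:
    "\<lbrace>x, y \<odot> z\<rbrace> + \<lbrace>z, y \<odot> x\<rbrace> + scale lam (\<lbrace>y, x\<rbrace> \<odot> z) + scale lam (\<lbrace>y, z\<rbrace> \<odot> x)
      + y \<odot> \<lbrace>x, z\<rbrace> = 0"

locale anticommutative_mock_gelfand_dorfman_algebra =
  mock_gelfand_dorfman_algebra lam scale ast bracket
  for lam :: complex
    and scale :: "complex \<Rightarrow> 'a::ab_group_add \<Rightarrow> 'a"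
    and ast :: "'a \<Rightarrow> 'a \<Rightarrow> 'a" (infixl "\<odot>" 70)
    and bracket :: "'a \<Rightarrow> 'a \<Rightarrow> 'a" ("\<lbrace>_,/ _\<rbrace>") +
  assumes anticommutative: "x \<odot> y = - (y \<odot> x)"

locale transposed_mock_poisson_algebra =
  product: nonassoc_algebra scale ast + lie: mock_lie_algebra scale bracket
  for \<delta> :: complex
    and scale :: "complex \<Rightarrow> 'a::ab_group_add \<Rightarrow> 'a"
    and ast :: "'a \<Rightarrow> 'a \<Rightarrow> 'a" (infixl "\<odot>" 70)
    and bracket :: "'a \<Rightarrow> 'a \<Rightarrow> 'a" ("\<lbrace>_,/ _\<rbrace>") +
  assumes anticommutative: "x \<odot> y = - (y \<odot> x)"
    and antiassociative: "(x \<odot> y) \<odot> z = - (x \<odot> (y \<odot> z))"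
    and transposed_leibniz:
      "scale (- 2 * \<delta>) (x \<odot> \<lbrace>y, z\<rbrace>) = \<lbrace>x \<odot> y, z\<rbrace> + \<lbrace>y, x \<odot> z\<rbrace>"

text \<open>A variety is a class of algebras. Its part with underlying additive group \<open>'a\<close> is the set
  of triples (scalar multiplication, product, bracket) on \<open>'a\<close> belonging to the class; the type
  \<open>'a\<close> is arbitrary.\<close>

definition transposed_mock_poisson_variety ::
  "complex \<Rightarrow> ((complex \<Rightarrow> 'a \<Rightarrow> 'a) \<times> ('a \<Rightarrow> 'a \<Rightarrow> 'a) \<times> ('a \<Rightarrow> 'a::ab_group_add \<Rightarrow> 'a)) set"
  where "transposed_mock_poisson_variety \<delta> =
    {(scale, ast, bracket). transposed_mock_poisson_algebra \<delta> scale ast bracket}"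

definition anticommutative_mock_gelfand_dorfman_variety ::
  "complex \<Rightarrow> ((complex \<Rightarrow> 'a \<Rightarrow> 'a) \<times> ('a \<Rightarrow> 'a \<Rightarrow> 'a) \<times> ('a \<Rightarrow> 'a::ab_group_add \<Rightarrow> 'a)) set"
  where "anticommutative_mock_gelfand_dorfman_variety lam =
    {(scale, ast, bracket). anticommutative_mock_gelfand_dorfman_algebra lam scale ast bracket}"

end

theory Submission
  imports Defs
begin

text \<open>For a symmetric bracket and an anti-commutative product, the bracket terms of either
  compatibility condition cancel when the condition is summed over the cyclic permutations of the
  variables. What remains is a multiple of the cyclic sum of \<open>x \<odot> \<lbrace>y, z\<rbrace>\<close>, by \<open>- 2 * \<delta>\<close> for transposed
  Poisson algebras and by \<open>1 - 2 * lam = 3 - 4 * \<delta>\<close> for Gelfand-Dorfman algebras. So this cyclic sum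
  vanishes, and modulo its vanishing the two compatibility conditions are equivalent.\<close>

context nonassoc_algebra
begin

lemma mult_minus_left: "mult (- x) y = - mult x y"
proof -
  interpret l: Vector_Spaces.linear scale scale "\<lambda>x. mult x y" by (rule linear_left)
  show ?thesis by (rule l.neg)
qed

lemma mult_minus_right: "mult x (- y) = - mult x y"
proof -
  interpret l: Vector_Spaces.linear scale scale "\<lambda>y. mult x y" by (rule linear_right)
  show ?thesis by (rule l.neg)
qed

end

context transposed_mock_poisson_algebra
begin

lemma cyclic_sum:
  assumes "\<delta> \<noteq> 0"
  shows "x \<odot> \<lbrace>y, z\<rbrace> + y \<odot> \<lbrace>z, x\<rbrace> + z \<odot> \<lbrace>x, y\<rbrace> = 0"
proof -
  have cancel: "\<lbrace>a \<odot> b, c\<rbrace> + \<lbrace>c, b \<odot> a\<rbrace> = 0" for a b c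
    by (metis anticommutative lie.mult_minus_left lie.symmetric add.right_inverse)
  \<comment> \<open>Each pair on the right joins terms from two different instances of
    \<open>transposed_leibniz\<close>, one with \<open>a \<odot> b\<close> and one with
    \<open>b \<odot> a\<close>, so that \<open>cancel\<close> applies.\<close>
  have "scale (- 2 * \<delta>) (x \<odot> \<lbrace>y, z\<rbrace> + y \<odot> \<lbrace>z, x\<rbrace> + z \<odot> \<lbrace>x, y\<rbrace>)
    = (\<lbrace>x \<odot> y, z\<rbrace> + \<lbrace>z, y \<odot> x\<rbrace>) + (\<lbrace>y \<odot> z, x\<rbrace> + \<lbrace>x, z \<odot> y\<rbrace>) + (\<lbrace>z \<odot> x, y\<rbrace> + \<lbrace>y, x \<odot> z\<rbrace>)"
    by (simp only: product.scale_right_distrib transposed_leibniz add.assoc add.commute add.left_commute)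
  also have "\<dots> = 0" by (simp only: cancel add_0)
  finally show ?thesis using assms by (simp only: product.scale_eq_0_iff) simp
qed

lemma anticommutative_mock_gelfand_dorfman:
  assumes "\<delta> \<noteq> 0" and lam: "lam = 2 * \<delta> - 1" and "lam \<noteq> 0"
  shows "anticommutative_mock_gelfand_dorfman_algebra lam scale ast bracket"
proof unfold_locales
  show "lam \<noteq> 0" by fact
  show "x \<odot> y = - (y \<odot> x)" for x y by (rule anticommutative)
  show "(a \<odot> b) \<odot> c + (a \<odot> c) \<odot> b = 0" for a b c
    by (metis antiassociative anticommutative product.mult_minus_right add.left_inverse)
  \<comment> \<open>The two \<open>lam\<close> terms cancel by anti-commutativity, and the other two
    cancel because a(bc) = -(ab)c = (ba)c = -b(ac).\<close>
  show "scale lam ((a \<odot> b) \<odot> c) + scale lam ((b \<odot> a) \<odot> c) + a \<odot> (b \<odot> c) + b \<odot> (a \<odot> c) = 0"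
    for a b c
  proof -
    have neg: "(a \<odot> b) \<odot> c = - ((b \<odot> a) \<odot> c)"
      by (metis anticommutative product.mult_minus_left)
    have "a \<odot> (b \<odot> c) = - (b \<odot> (a \<odot> c))"
      using neg by (metis antiassociative minus_minus)
    with neg show ?thesis by simp
  qed
  show "\<lbrace>x, y \<odot> z\<rbrace> + \<lbrace>z, y \<odot> x\<rbrace> + scale lam (\<lbrace>y, x\<rbrace> \<odot> z) + scale lam (\<lbrace>y, z\<rbrace> \<odot> x)
      + y \<odot> \<lbrace>x, z\<rbrace> = 0" for x y z
  proof -
    have leibniz: "\<lbrace>x, y \<odot> z\<rbrace> + \<lbrace>z, y \<odot> x\<rbrace> = scale (- 2 * \<delta>) (y \<odot> \<lbrace>x, z\<rbrace>)"
      using transposed_leibniz[of y x z] lie.symmetric by (metis add.commute)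
    \<comment> \<open>Moving the brackets to the right factor gives two of the three terms of the
      cyclic sum, so its vanishing turns them into a multiple of the third. All terms are then
      multiples of \<open>y \<odot> \<lbrace>x, z\<rbrace>\<close>, with total coefficient
      \<open>- 2 * \<delta> + lam + 1 = 0\<close>.\<close>
    have "scale lam (\<lbrace>y, x\<rbrace> \<odot> z) + scale lam (\<lbrace>y, z\<rbrace> \<odot> x)
        = - scale lam (z \<odot> \<lbrace>x, y\<rbrace> + x \<odot> \<lbrace>y, z\<rbrace>)"
      using anticommutative[of "\<lbrace>y, x\<rbrace>" z] anticommutative[of "\<lbrace>y, z\<rbrace>" x] lie.symmetric[of y x]
      by (simp add: product.scale_right_distrib)
    also have "z \<odot> \<lbrace>x, y\<rbrace> + x \<odot> \<lbrace>y, z\<rbrace> = - (y \<odot> \<lbrace>x, z\<rbrace>)"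
      using cyclic_sum[OF \<open>\<delta> \<noteq> 0\<close>, of x y z] lie.symmetric[of z x]
      by (simp add: eq_neg_iff_add_eq_0 ac_simps)
    finally have "\<lbrace>x, y \<odot> z\<rbrace> + \<lbrace>z, y \<odot> x\<rbrace>
        + (scale lam (\<lbrace>y, x\<rbrace> \<odot> z) + scale lam (\<lbrace>y, z\<rbrace> \<odot> x)) + y \<odot> \<lbrace>x, z\<rbrace>
      = scale (- 2 * \<delta> + lam + 1) (y \<odot> \<lbrace>x, z\<rbrace>)"
      by (simp add: leibniz product.scale_left_distrib product.scale_left_diff_distrib)
    then show ?thesis by (simp add: lam add.assoc)
  qed
qed

end

context anticommutative_mock_gelfand_dorfman_algebra
begin

text \<open>Anti-commutativity absorbs the signs when the \<open>lam\<close> terms change sides.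
  Every product with a bracket now has it as right factor, as in the cyclic sum.\<close>

lemma compatibility_right_factors:
  "\<lbrace>x, y \<odot> z\<rbrace> + \<lbrace>z, y \<odot> x\<rbrace> + y \<odot> \<lbrace>x, z\<rbrace> = scale lam (z \<odot> \<lbrace>x, y\<rbrace> + x \<odot> \<lbrace>y, z\<rbrace>)"
  using compatibility[of x y z] anticommutative[of "\<lbrace>y, x\<rbrace>" z] anticommutative[of "\<lbrace>y, z\<rbrace>" x]
    lie.symmetric[of y x]
  by (simp add: novikov.scale_right_distrib algebra_simps)

lemma cyclic_sum:
  assumes "lam \<noteq> 1 / 2"
  shows "x \<odot> \<lbrace>y, z\<rbrace> + y \<odot> \<lbrace>z, x\<rbrace> + z \<odot> \<lbrace>x, y\<rbrace> = 0" (is "?S = 0")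
proof -
  have cancel: "\<lbrace>a, b \<odot> c\<rbrace> + \<lbrace>a, c \<odot> b\<rbrace> = 0" for a b c
    by (metis anticommutative lie.mult_minus_right add.right_inverse)
  \<comment> \<open>The added pairs are zero by \<open>cancel\<close>. They are exactly the bracket
    terms needed to complete \<open>?S\<close> to the sum of the left sides of
    \<open>compatibility_right_factors\<close> at (x, y, z), (y, z, x) and (z, x, y).\<close>
  have "?S = (\<lbrace>x, y \<odot> z\<rbrace> + \<lbrace>x, z \<odot> y\<rbrace>) + (\<lbrace>y, z \<odot> x\<rbrace> + \<lbrace>y, x \<odot> z\<rbrace>) + (\<lbrace>z, x \<odot> y\<rbrace> + \<lbrace>z, y \<odot> x\<rbrace>) + ?S"
    by (simp only: cancel add_0)
  also have "\<dots> = (\<lbrace>x, y \<odot> z\<rbrace> + \<lbrace>z, y \<odot> x\<rbrace> + y \<odot> \<lbrace>x, z\<rbrace>)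
      + (\<lbrace>y, z \<odot> x\<rbrace> + \<lbrace>x, z \<odot> y\<rbrace> + z \<odot> \<lbrace>y, x\<rbrace>) + (\<lbrace>z, x \<odot> y\<rbrace> + \<lbrace>y, x \<odot> z\<rbrace> + x \<odot> \<lbrace>z, y\<rbrace>)"
    by (simp only: lie.symmetric[of z x] lie.symmetric[of y x] lie.symmetric[of z y] ac_simps)
  \<comment> \<open>Each of the three right sides omits one term of \<open>?S\<close>, so together
    they contain every term twice.\<close>
  also have "\<dots> = scale lam ?S + scale lam ?S"
    by (simp only: compatibility_right_factors)
      (simp only: novikov.scale_right_distrib ac_simps)
  finally have "?S = scale (2 * lam) ?S"
    by (simp only: mult_2 novikov.scale_left_distrib)
  then have "scale (2 * lam - 1) ?S = 0"
    by (simp only: novikov.scale_left_diff_distrib novikov.scale_one) simp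
  moreover have "2 * lam - 1 \<noteq> 0" using assms by (auto simp: field_simps)
  ultimately show ?thesis by (simp only: novikov.scale_eq_0_iff) simp
qed

lemma transposed_mock_poisson:
  assumes "lam = 2 * \<delta> - 1" and "\<delta> \<noteq> 3/4"
  shows "transposed_mock_poisson_algebra \<delta> scale ast bracket"
proof unfold_locales
  show "x \<odot> y = - (y \<odot> x)" for x y by (rule anticommutative)
  show "(x \<odot> y) \<odot> z = - (x \<odot> (y \<odot> z))" for x y z
  proof -
    have swap: "(a \<odot> b) \<odot> c = - ((a \<odot> c) \<odot> b)" for a b c
      using novikov.right_identity by (simp add: eq_neg_iff_add_eq_0)
    \<comment> \<open>Exchanging the last two factors changes the sign by \<open>swap\<close>, and
      exchanging the first two does so by anti-commutativity. A cyclic rotation of (xy)z is two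
      exchanges, hence preserves the value.\<close>
    have "(x \<odot> y) \<odot> z = (z \<odot> x) \<odot> y"
      by (metis swap anticommutative novikov.mult_minus_left)
    also have "\<dots> = (y \<odot> z) \<odot> x"
      by (metis swap anticommutative novikov.mult_minus_left)
    also have "\<dots> = - (x \<odot> (y \<odot> z))" by (rule anticommutative)
    finally show ?thesis .
  qed
  show "scale (- 2 * \<delta>) (x \<odot> \<lbrace>y, z\<rbrace>) = \<lbrace>x \<odot> y, z\<rbrace> + \<lbrace>y, x \<odot> z\<rbrace>" for x y z
  proof -
    have "\<delta> = (lam + 1) / 2" using assms(1) by simp
    with assms(2) have "lam \<noteq> 1 / 2" by (intro notI) simp
    then have "z \<odot> \<lbrace>y, x\<rbrace> + y \<odot> \<lbrace>x, z\<rbrace> = - (x \<odot> \<lbrace>y, z\<rbrace>)"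
      using cyclic_sum[of x y z] lie.symmetric[of z x] lie.symmetric[of y x]
      by (simp add: eq_neg_iff_add_eq_0 ac_simps)
    with compatibility_right_factors[of y x z]
    have "\<lbrace>y, x \<odot> z\<rbrace> + \<lbrace>z, x \<odot> y\<rbrace> = - scale lam (x \<odot> \<lbrace>y, z\<rbrace>) - x \<odot> \<lbrace>y, z\<rbrace>"
      by (simp add: eq_diff_eq)
    \<comment> \<open>The coefficient \<open>- lam - 1\<close> equals
      \<open>- 2 * \<delta>\<close>.\<close>
    also have "\<dots> = scale (- lam - 1) (x \<odot> \<lbrace>y, z\<rbrace>)"
      by (simp add: novikov.scale_left_diff_distrib)
    finally show ?thesis
      using assms(1) lie.symmetric[of z "x \<odot> y"] by (simp add: add.commute)
  qed
qed

end

theorem theorem6p12: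
  fixes \<delta> lam :: complex
  assumes "\<delta> \<noteq> 0" and "lam = 2 * \<delta> - 1" and "lam \<noteq> 0"
  shows "(\<forall>(scale :: complex \<Rightarrow> 'a::ab_group_add \<Rightarrow> 'a) ast bracket.
            transposed_mock_poisson_algebra \<delta> scale ast bracket \<longrightarrow>
            anticommutative_mock_gelfand_dorfman_algebra lam scale ast bracket) \<and>
         (\<delta> \<noteq> 3/4 \<longrightarrow>
           (\<forall>(scale :: complex \<Rightarrow> 'a \<Rightarrow> 'a) ast bracket.
             anticommutative_mock_gelfand_dorfman_algebra lam scale ast bracket \<longrightarrow>
             transposed_mock_poisson_algebra \<delta> scale ast bracket)) \<and>
         (\<delta> \<notin> {1/2, 3/4} \<longrightarrow>
           (transposed_mock_poisson_variety \<delta> ::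
             ((complex \<Rightarrow> 'a \<Rightarrow> 'a) \<times> ('a \<Rightarrow> 'a \<Rightarrow> 'a) \<times> ('a \<Rightarrow> 'a \<Rightarrow> 'a)) set) =
           anticommutative_mock_gelfand_dorfman_variety (2 * \<delta> - 1))"
proof -
  have poisson_to_gd: "anticommutative_mock_gelfand_dorfman_algebra lam scale ast bracket"
    if "transposed_mock_poisson_algebra \<delta> scale ast bracket"
    for scale :: "complex \<Rightarrow> 'a \<Rightarrow> 'a" and ast bracket
    using transposed_mock_poisson_algebra.anticommutative_mock_gelfand_dorfman[OF that] assms
    by blast
  have gd_to_poisson: "transposed_mock_poisson_algebra \<delta> scale ast bracket"
    if "\<delta> \<noteq> 3/4" and "anticommutative_mock_gelfand_dorfman_algebra lam scale ast bracket"
    for scale :: "complex \<Rightarrow> 'a \<Rightarrow> 'a" and ast bracket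
    using anticommutative_mock_gelfand_dorfman_algebra.transposed_mock_poisson[OF that(2)] assms that(1)
    by blast
  \<comment> \<open>Since \<open>lam \<noteq> 0\<close> says \<open>\<delta> \<noteq> 1/2\<close>,
    the only further value to exclude is 3/4.\<close>
  have "(transposed_mock_poisson_variety \<delta> ::
      ((complex \<Rightarrow> 'a \<Rightarrow> 'a) \<times> ('a \<Rightarrow> 'a \<Rightarrow> 'a) \<times> ('a \<Rightarrow> 'a \<Rightarrow> 'a)) set)
    = anticommutative_mock_gelfand_dorfman_variety (2 * \<delta> - 1)" if "\<delta> \<noteq> 3/4"
    unfolding transposed_mock_poisson_variety_def anticommutative_mock_gelfand_dorfman_variety_def
    using poisson_to_gd gd_to_poisson[OF that] assms(2) by auto
  with poisson_to_gd gd_to_poisson show ?thesis by blast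
qed

end
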